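(* Let $\kappa$ be an infinite cardinal, let $n$ be a positive integer, and let $P$ be a join-semilattice of breadth $n$ and cardinality $\kappa^{+(n-1)}$ whose principal ideals have cardinality $<\kappa$. Then, for every ideal $I\subseteq P$ of cardinality at most $\kappa$, there exists $x\in P$ such that $x\vee I$ is a chain.
   Context: $\kappa^{+(n-1)}$ denotes the $(n-1)$-st cardinal successor of $\kappa$ (so $\kappa^{+0}=\kappa$). Join-semilattices are nonempty; $x\le y$ iff $x\vee y=y$. A nonempty subset of a join-semilattice closed under binary joins is a join-subsemilattice; an ideal is a downward closed join-subsemilattice. The principal ideals of $P$ are the sets $\{y\in P:y\le x\}$, $x\in P$. For $x\in P$ and nonempty $S\subseteq P$, $x\vee S=\{x\vee y:y\in S\}$. $P$ has breadth at most $m$ ($m\in\omega$) if for every nonempty finite $X\subseteq P$ there is $Y\subseteq X$ with at most $m$ elements such that $\bigvee X=\bigvee Y$ (writing $\bigvee\emptyset$ means that $P$ has a least element $0_P$ and $\bigvee\emptyset=0_P$); the breadth of $P$ is the least such $m$, if one exists. *)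

theory Defs
  imports Main
begin

unbundle cardinal_syntax

text \<open>
  In HOL every application of \<^const>\<open>cardSuc\<close> changes the type of the cardinal, so it cannot be
  iterated a variable number of times as a function. Hence ``\<open>r\<close> is an \<open>m\<close>-th cardinal successor
  of \<open>\<kappa>\<close>'' is expressed as a relation, up to order isomorphism of cardinals (\<open>=o\<close>). The
  intermediate cardinals are taken on the type of \<open>r\<close>; this is no restriction, since they are
  smaller than \<open>r\<close> (see \<open>card_succ_pow_Suc_iff\<close>, \<open>card_succ_pow_unique\<close>).
\<close>

primrec card_succ_pow :: "'k rel \<Rightarrow> nat \<Rightarrow> 'a rel \<Rightarrow> bool" where
  "card_succ_pow \<kappa> 0 r \<longleftrightarrow> r =o \<kappa>"
| "card_succ_pow \<kappa> (Suc m) r \<longleftrightarrow> (\<exists>t :: 'a rel. card_succ_pow \<kappa> m t \<and> r =o cardSuc t)"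

definition join_subsemilattice :: "'a::semilattice_sup set \<Rightarrow> bool" where
  "join_subsemilattice S \<longleftrightarrow> S \<noteq> {} \<and> (\<forall>x\<in>S. \<forall>y\<in>S. sup x y \<in> S)"

definition join_ideal :: "'a::semilattice_sup set \<Rightarrow> bool" where
  "join_ideal I \<longleftrightarrow> join_subsemilattice I \<and> (\<forall>x\<in>I. \<forall>y. y \<le> x \<longrightarrow> y \<in> I)"

text \<open>
  \<open>is_finite_join Y s\<close>: the join of the finite set \<open>Y\<close> exists and equals \<open>s\<close>. For \<open>Y = {}\<close>
  (where \<^const>\<open>Sup_fin\<close> is unspecified) this says that \<open>s\<close> is the least element.
\<close>

definition is_finite_join :: "'a::semilattice_sup set \<Rightarrow> 'a \<Rightarrow> bool" where
  "is_finite_join Y s \<longleftrightarrow> finite Y \<and> (if Y = {} then (\<forall>z. s \<le> z) else s = Sup_fin Y)"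

text \<open>The semilattice is the whole type \<open>'a\<close>, passed as an \<^typ>\<open>'a itself\<close> argument.\<close>

definition breadth_at_most :: "'a::semilattice_sup itself \<Rightarrow> nat \<Rightarrow> bool" where
  "breadth_at_most _ m \<longleftrightarrow>
     (\<forall>X :: 'a set. finite X \<and> X \<noteq> {} \<longrightarrow>
        (\<exists>Y. Y \<subseteq> X \<and> card Y \<le> m \<and> is_finite_join Y (Sup_fin X)))"

definition has_breadth :: "'a::semilattice_sup itself \<Rightarrow> nat \<Rightarrow> bool" where
  "has_breadth T n \<longleftrightarrow> breadth_at_most T n \<and> (\<forall>m. breadth_at_most T m \<longrightarrow> n \<le> m)"

lemma Card_order_copy:
  fixes t :: "'b rel" and r :: "'a rel"
  assumes "Card_order t" "Card_order r" "t \<le>o r"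
  obtains u :: "'a rel" where "u =o t"
proof -
  have "|Field t| \<le>o |Field r|" using assms(3) by (rule card_of_mono2)
  then obtain f where f: "inj_on f (Field t)" "f ` Field t \<subseteq> Field r"
    using card_of_ordLeq by metis
  have "|Field t| =o |f ` Field t|"
    using inj_on_imp_bij_betw[OF f(1)] card_of_ordIso by blast
  then have "|f ` Field t| =o t"
    using ordIso_transitive[OF ordIso_symmetric card_of_Field_ordIso[OF assms(1)]] by simp
  then show ?thesis by (rule that)
qed

lemma card_succ_pow_Card_order:
  fixes r :: "'b rel"
  assumes "Card_order \<kappa>" "card_succ_pow \<kappa> m r"
  shows "Card_order r"
  using assms(2)
proof (induction m arbitrary: r)
  case 0
  then have "r =o \<kappa>" by simp
  with assms(1) show ?case by (rule Card_order_ordIso)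
next
  case (Suc m)
  from Suc.prems obtain t :: "'b rel" where
    t: "card_succ_pow \<kappa> m t" "r =o cardSuc t" by auto
  show ?case using Card_order_ordIso[OF cardSuc_Card_order[OF Suc.IH[OF t(1)]] t(2)] .
qed

lemma card_succ_pow_unique:
  fixes r :: "'a rel" and s :: "'b rel"
  assumes "Card_order \<kappa>" "card_succ_pow \<kappa> m r" "card_succ_pow \<kappa> m s"
  shows "r =o s"
  using assms(2,3)
proof (induction m arbitrary: r s)
  case 0
  then have "r =o \<kappa>" "s =o \<kappa>" by simp_all
  then show ?case by (rule ordIso_transitive[OF _ ordIso_symmetric])
next
  case (Suc m)
  then obtain t :: "'a rel" and u :: "'b rel" where
    t: "card_succ_pow \<kappa> m t" "r =o cardSuc t" and u: "card_succ_pow \<kappa> m u" "s =o cardSuc u"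
    by auto
  have "cardSuc t =o cardSuc u"
    using Suc.IH[OF t(1) u(1)] cardSuc_invar_ordIso
      card_succ_pow_Card_order[OF assms(1) t(1)] card_succ_pow_Card_order[OF assms(1) u(1)]
    by blast
  then show ?case
    using ordIso_transitive[OF t(2) ordIso_transitive[OF _ ordIso_symmetric[OF u(2)]]] by simp
qed

lemma card_succ_pow_ordIso:
  fixes r :: "'a rel" and s :: "'b rel"
  assumes "Card_order \<kappa>" "card_succ_pow \<kappa> m s" "r =o s"
  shows "card_succ_pow \<kappa> m r"
  using assms(2,3)
proof (induction m arbitrary: r s)
  case 0
  then have "s =o \<kappa>" by simp
  then show ?case using ordIso_transitive[OF 0(2)] by simp
next
  case (Suc m)
  then obtain t :: "'b rel" where t: "card_succ_pow \<kappa> m t" "s =o cardSuc t" by auto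
  have ct: "Card_order t" using card_succ_pow_Card_order[OF assms(1) t(1)] .
  have r: "r =o cardSuc t" using ordIso_transitive[OF Suc.prems(2) t(2)] .
  have cr: "Card_order r" using Card_order_ordIso[OF cardSuc_Card_order[OF ct] r] .
  have "t \<le>o r"
    using ordLeq_ordIso_trans[OF cardSuc_ordLeq[OF ct] ordIso_symmetric[OF r]] .
  then obtain u :: "'a rel" where u: "u =o t" using Card_order_copy[OF ct cr] by blast
  have "cardSuc u =o cardSuc t"
    using u cardSuc_invar_ordIso[OF Card_order_ordIso[OF ct u] ct] by blast
  then have "r =o cardSuc u" by (rule ordIso_transitive[OF r ordIso_symmetric])
  then show ?case using Suc.IH[OF t(1) u] by auto
qed

text \<open>The intermediate cardinal may live on any type \<open>'b\<close> that accommodates it.\<close>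

lemma card_succ_pow_Suc_iff:
  fixes r :: "'a rel" and t :: "'b rel"
  assumes "Card_order \<kappa>" "card_succ_pow \<kappa> m t"
  shows "card_succ_pow \<kappa> (Suc m) r \<longleftrightarrow> r =o cardSuc t"
proof
  assume "card_succ_pow \<kappa> (Suc m) r"
  then obtain u :: "'a rel" where u: "card_succ_pow \<kappa> m u" "r =o cardSuc u" by auto
  have "cardSuc u =o cardSuc t"
    using card_succ_pow_unique[OF assms(1) u(1) assms(2)] cardSuc_invar_ordIso
      card_succ_pow_Card_order[OF assms(1) u(1)] card_succ_pow_Card_order[OF assms] by blast
  then show "r =o cardSuc t" by (rule ordIso_transitive[OF u(2)])
next
  assume r: "r =o cardSuc t"
  have "card_succ_pow \<kappa> (Suc m) (cardSuc t)"
  proof -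
    have ct: "Card_order t" using card_succ_pow_Card_order[OF assms] .
    obtain u :: "'b set rel" where u: "u =o t"
      using Card_order_copy[OF ct cardSuc_Card_order[OF ct] cardSuc_ordLeq[OF ct]] by blast
    have "cardSuc t =o cardSuc u"
      using ordIso_symmetric[OF u] cardSuc_invar_ordIso[OF ct Card_order_ordIso[OF ct u]] by blast
    then show ?thesis using card_succ_pow_ordIso[OF assms u] by auto
  qed
  then show "card_succ_pow \<kappa> (Suc m) r" using card_succ_pow_ordIso[OF assms(1) _ r] by blast
qed

end

theory Submission
  imports Defs
begin

text \<open>
  If no \<open>x \<squnion> I\<close> is a chain, then every finite set \<open>H\<close> comes with \<open>a, b \<in> I\<close> such that
  \<open>\<Squnion>H \<squnion> a\<close> and \<open>\<Squnion>H \<squnion> b\<close> are incomparable. Sending \<open>S\<close> to the set of all elements below some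
  \<open>\<Squnion>S \<squnion> c\<close> with \<open>c \<in> I\<close> is a set mapping with values of size at most \<open>\<kappa>\<close>, so Kuratowski's free set
  argument yields a free set \<open>H\<close> with \<open>n - 1\<close> elements. Then \<open>{a, b} \<union> H\<close> consists of \<open>n + 1\<close>
  elements none of which lies below the join of the others, contradicting breadth \<open>n\<close>.
\<close>

text \<open>Splitting an element \<open>x\<close> off each \<open>(k+1)\<close>-element set turns
  the union into one over \<open>x \<in> A\<close>. Each member is handled by the induction
  hypothesis for \<open>S \<mapsto> F (insert x S)\<close>, so an infinite \<open>A\<close> absorbs
  the outer union.\<close>

lemma card_of_UNION_card_subsets:
  assumes "infinite A" and "\<And>S. finite S \<Longrightarrow> |F S| \<le>o |A|"
  shows "|\<Union>S\<in>{S. S \<subseteq> A \<and> finite S \<and> card S = k}. F S| \<le>o |A|"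
  using assms(2)
proof (induction k arbitrary: F)
  case 0
  have "{S. S \<subseteq> A \<and> finite S \<and> card S = 0} = {{}}" by auto
  with 0 show ?case by simp
next
  case (Suc k)
  let ?G = "\<lambda>x. \<Union>S\<in>{S. S \<subseteq> A \<and> finite S \<and> card S = k}. F (insert x S)"
  have "(\<Union>S\<in>{S. S \<subseteq> A \<and> finite S \<and> card S = Suc k}. F S) \<subseteq> (\<Union>x\<in>A. ?G x)"
  proof
    fix y assume "y \<in> (\<Union>S\<in>{S. S \<subseteq> A \<and> finite S \<and> card S = Suc k}. F S)"
    then obtain S where S: "S \<subseteq> A" "finite S" "card S = Suc k" "y \<in> F S" by auto
    then obtain x T where T: "S = insert x T" "x \<notin> T" "card T = k" "finite T"
      by (metis card_Suc_eq finite_insert)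
    with S show "y \<in> (\<Union>x\<in>A. ?G x)" by auto
  qed
  moreover have "|?G x| \<le>o |A|" for x
    by (rule Suc.IH) (simp add: Suc.prems)
  then have "|\<Union>x\<in>A. ?G x| \<le>o |A|"
    by (intro card_of_UNION_ordLeq_infinite[OF assms(1) card_of_mono1[OF subset_refl]] ballI)
  ultimately show ?case by (rule ordLeq_transitive[OF card_of_mono1])
qed

lemma card_succ_pow_ordLeq:
  fixes r :: "'b rel"
  assumes "Card_order \<kappa>" "card_succ_pow \<kappa> m r"
  shows "\<kappa> \<le>o r"
  using assms(2)
proof (induction m arbitrary: r)
  case 0
  then show ?case using ordIso_iff_ordLeq by auto
next
  case (Suc m)
  then obtain t :: "'b rel" where t: "card_succ_pow \<kappa> m t" "r =o cardSuc t" by auto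
  have "t \<le>o cardSuc t"
    using cardSuc_ordLeq card_succ_pow_Card_order[OF assms(1) t(1)] by blast
  then show ?case
    using Suc.IH[OF t(1)] t(2) ordLeq_transitive ordLeq_ordIso_trans ordIso_symmetric by blast
qed

text \<open>Induction on \<open>m\<close>: take \<open>A \<subseteq> X\<close> of the preceding
  cardinality, then \<open>x\<close> outside both \<open>A\<close> and every \<open>F S\<close> with
  \<open>S\<close> an \<open>m\<close>-element subset of \<open>A\<close>. A set
  \<open>H \<subseteq> A\<close> that is free for \<open>S \<mapsto> F (insert x S)\<close> stays
  free for \<open>F\<close> after \<open>x\<close> is added.\<close>

lemma Kuratowski_free_set:
  fixes X :: "'a set"
  assumes \<kappa>: "Cinfinite \<kappa>" and "card_succ_pow \<kappa> m |X|"
    and "\<And>S. finite S \<Longrightarrow> |F S| \<le>o \<kappa>"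
  shows "\<exists>H\<subseteq>X. finite H \<and> card H = m \<and> (\<forall>y\<in>H. y \<notin> F (H - {y}))"
  using assms(2,3)
proof (induction m arbitrary: X F)
  case 0
  show ?case by (intro exI[of _ "{}"]) auto
next
  case (Suc m)
  have \<kappa>_card: "Card_order \<kappa>" using \<kappa> by simp
  obtain t :: "'a rel" where t: "card_succ_pow \<kappa> m t" "|X| =o cardSuc t"
    using Suc.prems(1) by auto
  have t_card: "Card_order t" using card_succ_pow_Card_order[OF \<kappa>_card t(1)] .
  have t_less: "t <o |X|"
    using cardSuc_greater[OF t_card] t(2) ordLess_ordIso_trans ordIso_symmetric by blast
  have "|Field t| \<le>o |X|"
    using t_less card_of_Field_ordIso[OF t_card] ordIso_ordLeq_trans ordLess_imp_ordLeq by blast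
  \<comment> \<open>The field of \<open>t\<close> may lie outside \<open>X\<close>, so it is copied
    into \<open>X\<close>.\<close>
  then obtain f where f: "inj_on f (Field t)" "f ` Field t \<subseteq> X"
    using card_of_ordLeq by metis
  define A where "A = f ` Field t"
  have "|Field t| =o |A|"
    unfolding A_def using inj_on_imp_bij_betw[OF f(1)] card_of_ordIso by blast
  then have A: "|A| =o t"
    using ordIso_transitive[OF ordIso_symmetric card_of_Field_ordIso[OF t_card]] by blast
  have A_pow: "card_succ_pow \<kappa> m |A|" using card_succ_pow_ordIso[OF \<kappa>_card t(1) A] .
  have \<kappa>_le: "\<kappa> \<le>o |A|" using card_succ_pow_ordLeq[OF \<kappa>_card A_pow] .
  have inf: "infinite A"
    using cinfinite_mono[OF \<kappa>_le] \<kappa> by (simp add: cinfinite_def Field_card_of)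
  let ?U = "\<Union>S\<in>{S. S \<subseteq> A \<and> finite S \<and> card S = m}. F S"
  have "|?U| \<le>o |A|"
    using inf Suc.prems(2) \<kappa>_le
    by (intro card_of_UNION_card_subsets) (auto intro: ordLeq_transitive)
  then have "|A \<union> ?U| \<le>o |A|"
    using inf by (intro card_of_Un_ordLeq_infinite_Field) (auto simp: card_of_mono1 Field_card_of card_of_card_order_on)
  then have "|A \<union> ?U| <o |X|"
    using A t_less ordLeq_ordIso_trans ordLeq_ordLess_trans by blast
  then have "\<not> X \<subseteq> A \<union> ?U"
    using card_of_mono1 not_ordLess_ordLeq by blast
  then obtain x where x: "x \<in> X" "x \<notin> A" "x \<notin> ?U" by blast
  obtain H where H: "H \<subseteq> A" "finite H" "card H = m" "\<forall>y\<in>H. y \<notin> F (insert x (H - {y}))"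
    using Suc.IH[OF A_pow, of "\<lambda>S. F (insert x S)"] Suc.prems(2) by auto
  have "x \<notin> H" using x(2) H(1) by blast
  have "y \<notin> F (insert x H - {y})" if "y \<in> insert x H" for y
  proof (cases "y = x")
    case True
    \<comment> \<open>Here \<open>H\<close> is one of the sets \<open>S\<close> in
      \<open>?U\<close>, which \<open>x\<close> avoids.\<close>
    with \<open>x \<notin> H\<close> have "insert x H - {y} = H" by auto
    with True x(3) H(1-3) show ?thesis by auto
  next
    case False
    then have "insert x H - {y} = insert x (H - {y})" by auto
    with False that H(4) show ?thesis by auto
  qed
  then show ?case
    using H(1-3) \<open>x \<notin> H\<close> x(1) f(2) by (intro exI[of _ "insert x H"]) (auto simp: A_def)
qed

text \<open>Some \<open>z\<close> is missing from a \<open>Y\<close> with at most \<open>n\<close>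
  elements that already has the join of \<open>X\<close>. The bound \<open>2 \<le> card X\<close>
  keeps \<open>X - {z}\<close> nonempty, where \<open>Sup_fin\<close> is meaningful.\<close>

lemma breadth_at_most_redundant:
  fixes X :: "'a::semilattice_sup set"
  assumes "breadth_at_most TYPE('a) n" "finite X" "n < card X" "2 \<le> card X"
  shows "\<exists>z\<in>X. z \<le> Sup_fin (X - {z})"
proof -
  have "X \<noteq> {}" using assms(4) by auto
  with assms(1,2) obtain Y where Y: "Y \<subseteq> X" "card Y \<le> n" "is_finite_join Y (Sup_fin X)"
    unfolding breadth_at_most_def by blast
  have "Y \<noteq> X" using Y(2) assms(3) by auto
  then obtain z where z: "z \<in> X" "z \<notin> Y" using Y(1) by blast
  have "card (X - {z}) \<noteq> 0" using z(1) assms(2,4) by simp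
  then have ne: "X - {z} \<noteq> {}" by force
  have "z \<le> Sup_fin X" using z(1) assms(2) by (simp add: Sup_fin.coboundedI)
  also have "\<dots> \<le> Sup_fin (X - {z})"
  proof (cases "Y = {}")
    case True
    \<comment> \<open>With \<open>Y\<close> empty, \<open>Sup_fin X\<close> is the least
      element.\<close>
    then show ?thesis using Y(3) by (simp add: is_finite_join_def)
  next
    case False
    moreover have "Y \<subseteq> X - {z}" using Y(1) z(2) by blast
    ultimately show ?thesis
      using Y(3) assms(2) by (simp add: is_finite_join_def Sup_fin.subset_imp)
  qed
  finally show ?thesis using z(1) by blast
qed

theorem theorem2p6:
  fixes \<kappa> :: "'k rel" and n :: nat and I :: "'a::semilattice_sup set"
  assumes "Cinfinite \<kappa>"
    and "n > 0"
    and "has_breadth TYPE('a) n"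
    and "card_succ_pow \<kappa> (n - 1) |UNIV :: 'a set|"
    and "\<And>x :: 'a. |{y. y \<le> x}| <o \<kappa>"
    and "join_ideal I"
    and "|I| \<le>o \<kappa>"
  shows "\<exists>x :: 'a. Complete_Partial_Order.chain (\<le>) (sup x ` I)"
proof (rule ccontr)
  assume no_chain: "\<not> ?thesis"
  obtain c where c: "c \<in> I" and sup_I: "\<And>x y. x \<in> I \<Longrightarrow> y \<in> I \<Longrightarrow> sup x y \<in> I"
    using assms(6) by (auto simp: join_ideal_def join_subsemilattice_def)
  define F where "F S = (\<Union>d\<in>I. {y. y \<le> Sup_fin (insert d S)})" for S
  have "|F S| \<le>o \<kappa>" for S
  proof -
    have "infinite (Field \<kappa>)" "Card_order \<kappa>" using assms(1) by (auto simp: cinfinite_def)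
    then show ?thesis
      unfolding F_def using assms(7) ordLess_imp_ordLeq[OF assms(5)]
      by (intro card_of_UNION_ordLeq_infinite_Field) auto
  qed
  then obtain H where H: "finite H" "card H = n - 1" and free: "\<And>y. y \<in> H \<Longrightarrow> y \<notin> F (H - {y})"
    using Kuratowski_free_set[OF assms(1,4)] by meson
  \<comment> \<open>Inserting \<open>c\<close> keeps the join meaningful when \<open>H\<close> is empty, that is, when \<open>n = 1\<close>.\<close>
  define x where "x = Sup_fin (insert c H)"
  have "\<not> Complete_Partial_Order.chain (\<le>) (sup x ` I)" using no_chain by blast
  then obtain a b where ab: "a \<in> I" "b \<in> I" "\<not> sup x a \<le> sup x b" "\<not> sup x b \<le> sup x a"
    unfolding chain_def by blast
  have le_x: "h \<le> x" if "h \<in> H" for h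
    unfolding x_def using that H(1) by (simp add: Sup_fin.coboundedI)
  \<comment> \<open>Since \<open>x\<close> bounds \<open>H\<close>, the join of
    \<open>insert q H\<close> is below \<open>sup x q\<close>. This rules out \<open>a\<close> and
    \<open>b\<close> as the redundant element.\<close>
  have irr: "\<not> p \<le> Sup_fin (insert q H)" if "\<not> sup x p \<le> sup x q" for p q
  proof
    assume "p \<le> Sup_fin (insert q H)"
    also have "\<dots> \<le> sup x q"
      using H(1) le_x by (intro Sup_fin.boundedI) (auto intro: le_supI1)
    finally show False using that by simp
  qed
  have "a \<noteq> b" using ab(3) by auto
  have "a \<notin> H" "b \<notin> H" using ab(3,4) le_x by (auto simp: le_supI1)
  let ?X = "insert a (insert b H)"
  have "card ?X = n + 1"
    using H \<open>a \<noteq> b\<close> \<open>a \<notin> H\<close> \<open>b \<notin> H\<close> assms(2) by simp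
  then have "\<exists>z\<in>?X. z \<le> Sup_fin (?X - {z})"
    using assms(2,3) H(1) unfolding has_breadth_def
    by (intro breadth_at_most_redundant[of n]) auto
  then obtain z where z: "z \<in> ?X" "z \<le> Sup_fin (?X - {z})" by blast
  consider "z = a" | "z = b" | "z \<in> H" using z(1) by blast
  then show False
  proof cases
    case 1
    then have "?X - {z} = insert b H" using \<open>a \<noteq> b\<close> \<open>a \<notin> H\<close> by auto
    with z(2) 1 irr[OF ab(3)] show False by simp
  next
    case 2
    then have "?X - {z} = insert a H" using \<open>a \<noteq> b\<close> \<open>b \<notin> H\<close> by auto
    with z(2) 2 irr[OF ab(4)] show False by simp
  next
    case 3
    \<comment> \<open>\<open>F\<close> allows only one element of \<open>I\<close> in each join;
      \<open>sup a b\<close>, which is again in \<open>I\<close>, replaces both \<open>a\<close> and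
      \<open>b\<close>.\<close>
    let ?s = "Sup_fin (insert (sup a b) (H - {z}))"
    have ub: "h \<le> ?s" if "h \<in> insert (sup a b) (H - {z})" for h
      using that H(1) by (intro Sup_fin.coboundedI) auto
    have "a \<le> ?s" "b \<le> ?s" using ub[of "sup a b"] by auto
    moreover have "?X - {z} \<noteq> {}" using 3 \<open>a \<notin> H\<close> by auto
    ultimately have "Sup_fin (?X - {z}) \<le> ?s"
      using H(1) ub by (intro Sup_fin.boundedI) auto
    then have "z \<in> F (H - {z})"
      unfolding F_def using z(2) sup_I[OF ab(1,2)] order_trans by blast
    with free[OF 3] show False by simp
  qed
qed

end
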